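(* The class of all super-tournaments is not a well-quasi-order under minor containment; indeed, the subclass of all super-tournaments with no three edges mutually parallel is not a well-quasi-order under minor containment.
   Context: All digraphs are finite (loops and parallel edges are allowed); an edge $uv$ has tail $u$ and head $v$. Edges are parallel if they have the same tail and the same head. A digraph $G$ is a super-tournament if $uv\in E(G)$ or $vu\in E(G)$ for all distinct $u,v\in V(G)$. A digraph is strongly-connected if it is non-null and has a directed path from $u$ to $v$ for all vertices $u,v$. A class of digraphs is a well-quasi-order under minor containment if for every infinite sequence $G_1,G_2,\ldots$ of its members there exist $j>i\ge1$ such that $G_i$ is a minor of $G_j$. Minors: a digraph $H$ is a minor of a digraph $G$ if $H$ can be obtained from a subdigraph of $G$ by repeatedly contracting a strongly-connected subdigraph to a vertex. Equivalently, there is a minor mapping from $H$ to $G$, i.e. a mapping $\phi$ defined on $V(H)$ such that: (i) for every $v\in V(H)$, $\phi(v)$ is a non-null strongly-connected subdigraph of $G$; (ii) $\phi(u)$ and $\phi(v)$ are vertex-disjoint for distinct $u,v\in V(H)$; (iii) for all $u,v\in V(H)$ (not necessarily distinct), if there are $k$ edges of $H$ with tail $u$ and head $v$, then there are at least $k$ edges of $G$ with tail in $V(\phi(u))$ and head in $V(\phi(v))$ that are not contained in $E(\phi(x))$ for any $x\in V(H)$. *)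

theory Defs
  imports "Graph_Theory.Digraph_Isomorphism"
begin

(* The vertices of X are identified to w, which is meant to be a vertex of X. Only the
   arcs of X itself disappear; other arcs with both ends in X become loops at w. *)
definition contract ::
  "('a,'b) pre_digraph \<Rightarrow> ('a,'b) pre_digraph \<Rightarrow> 'a \<Rightarrow> ('a,'b) pre_digraph" where
  "contract G X w = \<lparr>
     verts = insert w (verts G - verts X),
     arcs = arcs G - arcs X,
     tail = (\<lambda>e. if tail G e \<in> verts X then w else tail G e),
     head = (\<lambda>e. if head G e \<in> verts X then w else head G e) \<rparr>"

definition contraction_step :: "('a,'b) pre_digraph \<Rightarrow> ('a,'b) pre_digraph \<Rightarrow> bool" where
  "contraction_step G K \<longleftrightarrow>
     (\<exists>X w. subgraph X G \<and> strongly_connected X \<and> w \<in> verts X \<and> K = contract G X w)"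

definition minor :: "('c,'d) pre_digraph \<Rightarrow> ('a,'b) pre_digraph \<Rightarrow> bool" where
  "minor H G \<longleftrightarrow>
     (\<exists>S K. subgraph S G \<and> contraction_step\<^sup>*\<^sup>* S K \<and> digraph_iso K H)"

(* Classes of all finite digraphs with some property are represented over (nat, nat):
   every finite digraph is isomorphic to one with natural numbers as vertices and arcs. *)
definition minor_wqo :: "('a,'b) pre_digraph set \<Rightarrow> bool" where
  "minor_wqo \<C> \<longleftrightarrow>
     (\<forall>G :: nat \<Rightarrow> ('a,'b) pre_digraph.
        (\<forall>i. G i \<in> \<C>) \<longrightarrow> (\<exists>i j. i < j \<and> minor (G i) (G j)))"

definition super_tournament :: "('a,'b) pre_digraph \<Rightarrow> bool" where
  "super_tournament G \<longleftrightarrow>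
     fin_digraph G \<and>
     (\<forall>u\<in>verts G. \<forall>v\<in>verts G. u \<noteq> v \<longrightarrow> u \<rightarrow>\<^bsub>G\<^esub> v \<or> v \<rightarrow>\<^bsub>G\<^esub> u)"

definition parallel :: "('a,'b) pre_digraph \<Rightarrow> 'b \<Rightarrow> 'b \<Rightarrow> bool" where
  "parallel G e f \<longleftrightarrow> tail G e = tail G f \<and> head G e = head G f"

definition no_three_parallel :: "('a,'b) pre_digraph \<Rightarrow> bool" where
  "no_three_parallel G \<longleftrightarrow>
     \<not> (\<exists>e\<in>arcs G. \<exists>f\<in>arcs G. \<exists>g\<in>arcs G. distinct [e, f, g] \<and>
          parallel G e f \<and> parallel G f g \<and> parallel G e g)"

end

theory Submission
  imports Defs "HOL-Library.Countable"
begin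

text \<open>
  If every arc of a digraph \<open>G\<close> increases with respect to an order on the vertices, then \<open>G\<close> has
  no directed cycle, so a strongly connected subgraph is a single vertex without arcs and
  contracting it changes nothing. The minors of \<open>G\<close> are therefore its subgraphs up to isomorphism
  (\<open>minor_ascendingE\<close>), and it suffices to find infinitely many acyclic super-tournaments none of
  which embeds into another.

  Doubling some arcs of the transitive tournament on \<open>0, \<dots>, n - 1\<close> amounts to choosing a graph on
  these vertices. An embedding of one such digraph into another preserves the order of the vertices
  and sends doubled pairs to doubled pairs, so it is an order-preserving embedding of the chosen
  graphs. The cycles \<open>0, 1, \<dots>, n - 1, 0\<close> with \<open>n \<ge> 3\<close> do not contain each other as subgraphs.
  Doubling along them thus yields an infinite antichain (\<open>minor_cycle_doubled_imp_eq\<close>) whose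
  members have no three parallel arcs.
\<close>

section \<open>Minors of acyclic digraphs\<close>

definition ascending :: "('a::order, 'b) pre_digraph \<Rightarrow> bool" where
  "ascending G \<longleftrightarrow> (\<forall>e\<in>arcs G. tail G e < head G e)"

lemma ascending_subgraph:
  assumes "subgraph S G" "ascending G"
  shows "ascending S"
  using assms by (auto simp: ascending_def subgraph_def compatible_def)

lemma ascending_reachable_le:
  assumes "ascending G" "u \<rightarrow>\<^sup>*\<^bsub>G\<^esub> v"
  shows "u \<le> v"
  using assms(2) unfolding reachable_def
proof (induction rule: rtrancl_on.induct)
  case (rtrancl_on_into_rtrancl_on a b c)
  have "b < c"
    using rtrancl_on_into_rtrancl_on.hyps assms(1) by (auto simp: arcs_ends_conv ascending_def)
  then show ?case
    using rtrancl_on_into_rtrancl_on.IH by simp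
qed simp

lemma ascending_strongly_connected:
  assumes "ascending X" "strongly_connected X" "wf_digraph X" "w \<in> verts X"
  shows "verts X = {w}" "arcs X = {}"
proof -
  have eq: "u = v" if "u \<in> verts X" "v \<in> verts X" for u v
    using assms(1,2) that by (auto simp: strongly_connected_def intro!: antisym ascending_reachable_le)
  then show "verts X = {w}"
    using assms(4) by blast
  show "arcs X = {}"
  proof (rule equals0I)
    fix e assume e: "e \<in> arcs X"
    then have "tail X e = head X e"
      using eq wf_digraph.wellformed[OF assms(3)] by blast
    with e assms(1) show False
      by (auto simp: ascending_def)
  qed
qed

lemma ascending_contraction_step:
  assumes "ascending G" "contraction_step G K"
  shows "K = G"
proof -
  obtain X w where X: "subgraph X G" "strongly_connected X" "w \<in> verts X"
    and K: "K = contract G X w"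
    using assms(2) by (auto simp: contraction_step_def)
  have "ascending X" "wf_digraph X"
    using X(1) assms(1) ascending_subgraph by (auto simp: subgraph_def)
  then have "verts X = {w}" "arcs X = {}"
    using ascending_strongly_connected X by blast+
  moreover have "w \<in> verts G"
    using X by (auto simp: subgraph_def)
  ultimately show ?thesis
    unfolding K contract_def by (intro pre_digraph.equality) auto
qed

lemma minor_ascendingE:
  assumes "minor H G" "ascending G"
  obtains \<phi> \<psi> where "\<phi> ` verts H \<subseteq> verts G" "inj_on \<psi> (arcs H)" "\<psi> ` arcs H \<subseteq> arcs G"
    "\<forall>e\<in>arcs H. tail G (\<psi> e) = \<phi> (tail H e) \<and> head G (\<psi> e) = \<phi> (head H e)"
proof -
  obtain S K where SG: "subgraph S G" and SK: "contraction_step\<^sup>*\<^sup>* S K" and KH: "digraph_iso K H"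
    using assms(1) by (auto simp: minor_def)
  from SG assms(2) have "ascending S"
    by (rule ascending_subgraph)
  with SK have "K = S"
    by (induction rule: rtranclp_induct) (auto dest: ascending_contraction_step)
  then obtain f where f: "pre_digraph.digraph_isomorphism S f" and H: "H = app_iso f S"
    using KH by (auto simp: digraph_iso_def)
  have SG': "wf_digraph S" "verts S \<subseteq> verts G" "arcs S \<subseteq> arcs G" "tail S = tail G" "head S = head G"
    using SG by (auto simp: subgraph_def compatible_def)
  interpret S: wf_digraph S by fact
  define \<phi> where "\<phi> = iso_verts (pre_digraph.inv_iso S f)"
  define \<psi> where "\<psi> = iso_arcs (pre_digraph.inv_iso S f)"
  have \<phi>: "\<phi> (iso_verts f v) = v" if "v \<in> verts S" for v
    using f that by (simp add: \<phi>_def)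
  have \<psi>: "\<psi> (iso_arcs f e) = e" if "e \<in> arcs S" for e
    using f that by (simp add: \<psi>_def)
  show ?thesis
  proof
    show "inj_on \<psi> (arcs H)"
      by (auto simp: H inj_on_def \<psi>)
    show "\<phi> ` verts H \<subseteq> verts G" "\<psi> ` arcs H \<subseteq> arcs G"
      using SG' by (auto simp: H \<phi> \<psi>)
    show "\<forall>e\<in>arcs H. tail G (\<psi> e) = \<phi> (tail H e) \<and> head G (\<psi> e) = \<phi> (head H e)"
      using f by (auto simp: H \<phi> \<psi> S.iso_verts_tail S.iso_verts_head SG'(4,5)[symmetric])
  qed
qed

section \<open>Transitive tournaments doubled along a Hamiltonian cycle\<close>

definition cycle_edge :: "nat \<Rightarrow> nat \<Rightarrow> nat \<Rightarrow> bool" where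
  "cycle_edge n u v \<longleftrightarrow> v = Suc u \<or> u = 0 \<and> v = n - 1"

text \<open>
  An arc is the code of a triple of its tail, its head and a Boolean that separates the two
  parallel arcs of a doubled pair.
\<close>

definition cycle_doubled :: "nat \<Rightarrow> (nat, nat) pre_digraph" where
  "cycle_doubled n = \<lparr>
     verts = {..<n},
     arcs = to_nat ` {(u, v, b :: bool). u < v \<and> v < n \<and> (b \<longrightarrow> cycle_edge n u v)},
     tail = (\<lambda>e. fst (from_nat e :: nat \<times> nat \<times> bool)),
     head = (\<lambda>e. fst (snd (from_nat e :: nat \<times> nat \<times> bool))) \<rparr>"

lemma verts_cycle_doubled: "verts (cycle_doubled n) = {..<n}"
  by (simp add: cycle_doubled_def)

lemma ends_cycle_doubled:
  "tail (cycle_doubled n) (to_nat (u :: nat, v :: nat, b :: bool)) = u"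
  "head (cycle_doubled n) (to_nat (u :: nat, v :: nat, b :: bool)) = v"
  by (simp_all add: cycle_doubled_def)

lemma in_arcs_cycle_doubled:
  "to_nat (u :: nat, v :: nat, b :: bool) \<in> arcs (cycle_doubled n) \<longleftrightarrow>
     u < v \<and> v < n \<and> (b \<longrightarrow> cycle_edge n u v)"
  by (auto simp: cycle_doubled_def)

lemma cycle_doubled_arcE:
  assumes "e \<in> arcs (cycle_doubled n)"
  obtains u v :: nat and b :: bool where
    "e = to_nat (u, v, b)" "u < v" "v < n" "b \<Longrightarrow> cycle_edge n u v"
  using assms by (auto simp: cycle_doubled_def)

lemma ascending_cycle_doubled: "ascending (cycle_doubled n)"
  by (auto simp: ascending_def ends_cycle_doubled elim!: cycle_doubled_arcE)

lemma super_tournament_cycle_doubled: "super_tournament (cycle_doubled n)"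
proof -
  have "finite {(u, v, b :: bool). u < v \<and> v < n \<and> (b \<longrightarrow> cycle_edge n u v)}"
    by (rule finite_subset[of _ "{..<n} \<times> {..<n} \<times> UNIV"]) auto
  then have "finite (arcs (cycle_doubled n))"
    by (simp add: cycle_doubled_def)
  moreover have "wf_digraph (cycle_doubled n)"
    by unfold_locales (auto simp: verts_cycle_doubled ends_cycle_doubled elim!: cycle_doubled_arcE)
  ultimately have "fin_digraph (cycle_doubled n)"
    by (simp add: wf_digraph.fin_digraphI verts_cycle_doubled)
  moreover have "u \<rightarrow>\<^bsub>cycle_doubled n\<^esub> v" if "u < v" "v < n" for u v
  proof -
    have "to_nat (u, v, False) \<in> arcs (cycle_doubled n)"
      using that by (simp add: in_arcs_cycle_doubled)
    then show ?thesis
      unfolding arcs_ends_conv by (force simp: ends_cycle_doubled)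
  qed
  ultimately show ?thesis
    by (auto simp: super_tournament_def verts_cycle_doubled dest: nat_neq_iff[THEN iffD1])
qed

lemma no_three_parallel_cycle_doubled: "no_three_parallel (cycle_doubled n)"
proof -
  have False
    if arcs: "e \<in> arcs (cycle_doubled n)" "f \<in> arcs (cycle_doubled n)" "g \<in> arcs (cycle_doubled n)"
      and par: "parallel (cycle_doubled n) e f" "parallel (cycle_doubled n) f g"
      and dist: "distinct [e, f, g]" for e f g
  proof -
    obtain u v u' v' u'' v'' :: nat and a b c :: bool where
      "e = to_nat (u, v, a)" "f = to_nat (u', v', b)" "g = to_nat (u'', v'', c)"
      using arcs by (elim cycle_doubled_arcE)
    with par dist have "a \<noteq> b" "b \<noteq> c" "a \<noteq> c"
      by (auto simp: parallel_def ends_cycle_doubled)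
    then show False
      by blast
  qed
  then show ?thesis
    unfolding no_three_parallel_def by blast
qed

lemma parallel_cycle_doubled_imp_cycle_edge:
  assumes "e \<in> arcs (cycle_doubled n)" "f \<in> arcs (cycle_doubled n)" "e \<noteq> f"
    "parallel (cycle_doubled n) e f"
  shows "cycle_edge n (tail (cycle_doubled n) e) (head (cycle_doubled n) e)"
  using assms by (auto simp: parallel_def ends_cycle_doubled elim!: cycle_doubled_arcE)

section \<open>The antichain\<close>

text \<open>
  Since \<open>m \<ge> 3\<close>, the value \<open>\<phi> 1\<close> lies strictly between the ends of the image of the edge
  \<open>{0, m - 1}\<close>, so this image can only be the edge \<open>{0, n - 1}\<close>. Then the other edges must go to
  pairs of consecutive numbers, which leaves no room for gaps.
\<close>

lemma cycle_edge_embedding_imp_eq: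
  fixes \<phi> :: "nat \<Rightarrow> nat"
  assumes "3 \<le> m"
    and mono: "\<And>u v. u < v \<Longrightarrow> v < m \<Longrightarrow> \<phi> u < \<phi> v"
    and bound: "\<And>v. v < m \<Longrightarrow> \<phi> v < n"
    and edge: "\<And>u v. u < v \<Longrightarrow> v < m \<Longrightarrow> cycle_edge m u v \<Longrightarrow> cycle_edge n (\<phi> u) (\<phi> v)"
  shows "m = n"
proof -
  have "\<phi> 0 < \<phi> 1" "\<phi> 1 < \<phi> (m - 1)" "\<phi> (m - 1) < n"
    using mono[of 0 1] mono[of 1 "m - 1"] bound[of "m - 1"] assms(1) by auto
  moreover have "cycle_edge n (\<phi> 0) (\<phi> (m - 1))"
    using edge[of 0 "m - 1"] assms(1) by (simp add: cycle_edge_def)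
  ultimately have ends: "\<phi> 0 = 0" "\<phi> (m - 1) = n - 1" "\<phi> 1 < n - 1" "n > 0"
    by (auto simp: cycle_edge_def)
  have "\<phi> i = i" if "i < m" for i
    using that
  proof (induction i)
    case (Suc i)
    have "cycle_edge n (\<phi> i) (\<phi> (Suc i))"
      using edge[of i "Suc i"] Suc.prems by (simp add: cycle_edge_def)
    then show ?case
      using Suc ends by (auto simp: cycle_edge_def)
  qed (use ends in simp)
  from this[of "m - 1"] show ?thesis
    using ends assms(1) by auto
qed

lemma minor_cycle_doubled_imp_eq:
  assumes "minor (cycle_doubled m) (cycle_doubled n)" "3 \<le> m"
  shows "m = n"
proof -
  let ?H = "cycle_doubled m" and ?G = "cycle_doubled n"
  obtain \<phi> \<psi> where \<phi>: "\<phi> ` verts ?H \<subseteq> verts ?G"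
    and inj: "inj_on \<psi> (arcs ?H)" and \<psi>: "\<psi> ` arcs ?H \<subseteq> arcs ?G"
    and ends: "\<forall>e\<in>arcs ?H. tail ?G (\<psi> e) = \<phi> (tail ?H e) \<and> head ?G (\<psi> e) = \<phi> (head ?H e)"
    by (rule minor_ascendingE[OF assms(1) ascending_cycle_doubled])
  show ?thesis
  proof (rule cycle_edge_embedding_imp_eq[OF assms(2)])
    show "\<phi> v < n" if "v < m" for v
      using \<phi> that by (auto simp: verts_cycle_doubled)
  next
    fix u v :: nat
    assume uv: "u < v" "v < m"
    let ?e = "\<lambda>b :: bool. to_nat (u, v, b)"
    have e: "?e False \<in> arcs ?H"
      using uv by (simp add: in_arcs_cycle_doubled)
    then have e': "\<psi> (?e False) \<in> arcs ?G"
        "tail ?G (\<psi> (?e False)) = \<phi> u" "head ?G (\<psi> (?e False)) = \<phi> v"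
      using \<psi> ends by (auto simp: ends_cycle_doubled)
    then show "\<phi> u < \<phi> v"
      using ascending_cycle_doubled[of n] by (auto simp: ascending_def)
    assume "cycle_edge m u v"
    then have f: "?e True \<in> arcs ?H"
      using uv by (simp add: in_arcs_cycle_doubled)
    then have f': "\<psi> (?e True) \<in> arcs ?G"
        "tail ?G (\<psi> (?e True)) = \<phi> u" "head ?G (\<psi> (?e True)) = \<phi> v"
      using \<psi> ends by (auto simp: ends_cycle_doubled)
    have "\<psi> (?e False) \<noteq> \<psi> (?e True)"
      using inj_onD[OF inj _ e f] by auto
    from parallel_cycle_doubled_imp_cycle_edge[OF e'(1) f'(1) this]
    show "cycle_edge n (\<phi> u) (\<phi> v)"
      using e' f' by (simp add: parallel_def)
  qed
qed

lemma not_minor_wqo_if_cycle_doubled: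
  assumes "\<And>n. cycle_doubled n \<in> \<C>"
  shows "\<not> minor_wqo \<C>"
proof
  assume "minor_wqo \<C>"
  then obtain i j where "i < j" "minor (cycle_doubled (i + 3)) (cycle_doubled (j + 3))"
    using assms unfolding minor_wqo_def
    by (auto dest!: spec[of _ "\<lambda>i. cycle_doubled (i + 3)"])
  then show False
    using minor_cycle_doubled_imp_eq[of "i + 3" "j + 3"] by simp
qed

theorem mainTheorem6:
  shows "\<not> minor_wqo {G :: (nat, nat) pre_digraph. super_tournament G} \<and>
         \<not> minor_wqo {G :: (nat, nat) pre_digraph. super_tournament G \<and> no_three_parallel G}"
  by (simp add: not_minor_wqo_if_cycle_doubled super_tournament_cycle_doubled
      no_three_parallel_cycle_doubled)

end
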